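(* Let $p$ be a prime. For any positive integers $k$ and $\ell$, the number of patterns $\alpha\in\mathbb F_p^k$ such that $f_{\alpha}(p, n)=\Omega(n^{1/(p^\ell -1)})$ is no more than $p^{2\cdot p^\ell -1}$. For all other patterns $\alpha\in\mathbb F_p^k$ not satisfying this property, $f_{\alpha}(p, n)=O(n^{1/p^\ell})$.
   Context: Let $[n]=\{1,\ldots,n\}$. For a prime $p$ and $\alpha=(a_1,\ldots,a_k)\in\mathbb F_p^k$, a family $\mathcal F\subset 2^{[n]}$ is $\alpha$-intersecting modulo $p$ if for each $i\in[k]$ and any $i$ distinct members $F_1,\ldots,F_i\in\mathcal F$ one has $|F_1\cap\cdots\cap F_i|\equiv a_i\pmod p$. Let $f_\alpha(p,n)$ be the maximum size of an $\alpha$-intersecting family $\mathcal F\subset 2^{[n]}$ modulo $p$. Asymptotics are as $n\to\infty$ with $p,k,\ell,\alpha$ fixed: $f=O(g)$ means there is a constant $c>0$ with $f(n)\le c\,g(n)$ for all sufficiently large $n$; $f=\Omega(g)$ means $g=O(f)$. *)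

theory Defs
  imports Complex_Main "HOL-Library.FuncSet" "HOL-Library.Landau_Symbols"
    "HOL-Computational_Algebra.Primes" "HOL-Number_Theory.Cong"
begin

text \<open>
  Elements of the prime field with \<open>p\<close> elements are represented by their canonical
  residues \<open>0, \<dots>, p - 1\<close>, and a vector by an extensional function on \<open>{1..k}\<close>,
  so that distinct members of \<open>patterns p k\<close> are distinct vectors.
\<close>

definition patterns :: "nat \<Rightarrow> nat \<Rightarrow> (nat \<Rightarrow> nat) set" where
  "patterns p k = {1..k} \<rightarrow>\<^sub>E {0..<p}"

text \<open>
  A choice of \<open>i\<close> distinct members is a subfamily of cardinality \<open>i\<close>; since \<open>i \<ge> 1\<close>,
  it is finite and nonempty even if the ambient family is infinite.
\<close>

definition intersecting_mod ::
    "nat \<Rightarrow> nat \<Rightarrow> (nat \<Rightarrow> nat) \<Rightarrow> nat set set \<Rightarrow> bool" where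
  "intersecting_mod p k \<alpha> \<F> \<longleftrightarrow>
     (\<forall>i\<in>{1..k}. \<forall>\<G>. \<G> \<subseteq> \<F> \<and> card \<G> = i \<longrightarrow> [card (\<Inter>\<G>) = \<alpha> i] (mod p))"

text \<open>
  The maximum below ranges over a finite set, which contains \<open>0\<close> because the empty family
  satisfies the condition vacuously.
\<close>

definition max_intersecting :: "nat \<Rightarrow> nat \<Rightarrow> (nat \<Rightarrow> nat) \<Rightarrow> nat \<Rightarrow> nat" where
  "max_intersecting p k \<alpha> n =
     Max {card \<F> | \<F>. \<F> \<subseteq> Pow {1..n} \<and> intersecting_mod p k \<alpha> \<F>}"

end

theory Submission
  imports Defs
begin

text \<open>
  Put \<open>q = p ^ l\<close>. The dichotomy is governed by whether \<open>\<alpha> (i + q) = \<alpha> i\<close> for all \<open>i \<ge> q\<close> with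
  \<open>i + q \<le> k\<close>; such a pattern is determined by its first \<open>2 * q - 1\<close> entries.

  If the condition fails at \<open>i = s + q\<close>, fix \<open>s\<close> members of the family and let \<open>A\<close>, \<open>B\<close> range over the
  \<open>q\<close>-subsets of the remaining \<open>m\<close> members. Modulo \<open>p\<close>, the matrix with entries
  \<open>g \<bar>A \<inter> B\<bar> = \<alpha> (s + 2 * q - \<bar>A \<inter> B\<bar>)\<close> has rank at most \<open>n\<close>, being a Gram matrix of
  indicator vectors of intersections. Newton expansion \<open>g j = (\<Sum>t\<le>q. e t * (j choose t))\<close> shows that it
  differs from \<open>e q\<close> times the identity by a matrix of rank \<open>O(m ^ (q - 1))\<close>. For \<open>t < q\<close> the
  function \<open>j choose t\<close> is \<open>q\<close>-periodic modulo \<open>p\<close>, so \<open>g q \<noteq> g 0\<close> forces \<open>e q \<noteq> 0\<close>, and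
  \<open>m choose q \<le> n + O(m ^ (q - 1))\<close>.

  If the condition holds, sets of size less than \<open>q\<close> and complements of such sets, with suitable
  multiplicities, form the dual of an \<open>\<alpha>\<close>-intersecting family with \<open>m\<close> members on
  \<open>O(m ^ (q - 1))\<close> points.
\<close>

section \<open>Binomial coefficients modulo a prime\<close>

text \<open>Otherwise the coefficient would be coprime to \<open>p ^ l\<close>, and the absorption
  identity would force \<open>p ^ l\<close> to divide the smaller positive number
  \<open>k\<close>.\<close>

lemma prime_dvd_prime_power_choose:
  fixes p :: nat
  assumes "prime p" "0 < k" "k < p ^ l"
  shows "p dvd (p ^ l choose k)"
proof (rule ccontr)
  assume "\<not> p dvd (p ^ l choose k)"
  then have cop: "coprime (p ^ l) (p ^ l choose k)"
    using assms(1) by (simp add: prime_imp_coprime)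
  have "k * (p ^ l choose k) = p ^ l * ((p ^ l - 1) choose (k - 1))"
    using times_binomial_minus1_eq assms(2) by blast
  then have "p ^ l dvd k * (p ^ l choose k)"
    by simp
  then have "p ^ l dvd k"
    using cop coprime_dvd_mult_left_iff by blast
  then show False
    using assms(2,3) by (meson dvd_imp_le leD)
qed

text \<open>In the Vandermonde expansion every term with \<open>1 \<le> t \<le> d\<close> contains
  the factor \<open>p ^ l choose t\<close>, a multiple of \<open>p\<close>; only
  \<open>t = 0\<close> survives.\<close>

lemma choose_add_prime_power_cong:
  fixes p :: nat
  assumes "prime p" "d < p ^ l"
  shows "[(j + p ^ l) choose d = j choose d] (mod p)"
proof -
  let ?q = "p ^ l"
  have "(j + ?q) choose d = (\<Sum>t\<le>d. (?q choose t) * (j choose (d - t)))"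
    using vandermonde[of ?q j d] by (simp add: add.commute)
  also have "\<dots> = (j choose d) + (\<Sum>t=1..d. (?q choose t) * (j choose (d - t)))"
    by (simp add: atMost_atLeast0 sum.atLeast_Suc_atMost)
  finally have eq: "(j + ?q) choose d = (j choose d) + (\<Sum>t=1..d. (?q choose t) * (j choose (d - t)))" .
  have "p dvd (\<Sum>t=1..d. (?q choose t) * (j choose (d - t)))"
    using assms by (intro dvd_sum dvd_mult2 prime_dvd_prime_power_choose) auto
  then show ?thesis
    unfolding eq by (simp add: cong_def mod_add_right_eq[symmetric] dvd_eq_mod_eq_0)
qed

lemma choose_mod_prime_power_cong:
  fixes p :: nat
  assumes "prime p" "d < p ^ l"
  shows "[j choose d = (j mod p ^ l) choose d] (mod p)"
proof -
  have *: "[(r + t * p ^ l) choose d = r choose d] (mod p)" for r t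
  proof (induction t)
    case (Suc t)
    have "[((r + t * p ^ l) + p ^ l) choose d = (r + t * p ^ l) choose d] (mod p)"
      using assms by (rule choose_add_prime_power_cong)
    with Suc show ?case
      by (metis (no_types, lifting) add.assoc add.commute cong_trans mult_Suc)
  qed simp
  show ?thesis
    using *[of "j mod p ^ l" "j div p ^ l"] by (simp only: mod_div_mult_eq)
qed

text \<open>Forward substitution: the unit diagonal avoids division, so the solution stays integral
  and can later be read modulo \<open>p\<close>.\<close>

lemma lower_unitriangular_solvable:
  fixes T :: "nat \<Rightarrow> nat \<Rightarrow> int"
  assumes "\<And>i. T i i = 1" "\<And>i d. i < d \<Longrightarrow> T i d = 0"
  shows "\<exists>c. \<forall>i<N. (\<Sum>d<N. c d * T i d) = h i"
proof (induction N)
  case (Suc N)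
  then obtain c where c: "\<forall>i<N. (\<Sum>d<N. c d * T i d) = h i" by blast
  define c' where "c' = c(N := h N - (\<Sum>d<N. c d * T N d))"
  have "(\<Sum>d<N. c' d * T i d) = (\<Sum>d<N. c d * T i d)" for i
    by (intro sum.cong) (auto simp: c'_def)
  then have "\<forall>i<Suc N. (\<Sum>d<Suc N. c' d * T i d) = h i"
    using c assms by (auto simp: less_Suc_eq c'_def)
  then show ?case by blast
qed simp

lemma upper_unitriangular_solvable:
  fixes T :: "nat \<Rightarrow> nat \<Rightarrow> int"
  assumes "\<And>i. T i i = 1" "\<And>i d. d < i \<Longrightarrow> T i d = 0"
  shows "\<exists>c. \<forall>i<N. (\<Sum>d<N. c d * T i d) = h i"
proof (induction N arbitrary: h)
  case (Suc N)
  \<comment> \<open>Back substitution: the last unknown must be \<open>h N\<close>, and its column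
    moves to the right-hand side.\<close>
  from Suc[of "\<lambda>i. h i - h N * T i N"]
  obtain c where c: "\<forall>i<N. (\<Sum>d<N. c d * T i d) = h i - h N * T i N" by blast
  define c' where "c' = c(N := h N)"
  have "(\<Sum>d<N. c' d * T i d) = (\<Sum>d<N. c d * T i d)" for i
    by (intro sum.cong) (auto simp: c'_def)
  then have "\<forall>i<Suc N. (\<Sum>d<Suc N. c' d * T i d) = h i"
    using c assms by (auto simp: less_Suc_eq c'_def)
  then show ?case by blast
qed simp

section \<open>Non-periodic patterns\<close>

text \<open>
  The rank bound by counting: \<open>c \<mapsto> \<Sum>A. c A * u A\<close> embeds the vectors modulo \<open>p\<close> on \<open>I\<close>
  into those on \<open>Y\<close>, since pairing with \<open>v B\<close> recovers \<open>e * c B\<close>.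
\<close>

lemma card_le_of_biorthogonal_mod:
  fixes u v :: "'a \<Rightarrow> 'b \<Rightarrow> int" and p :: nat
  assumes "finite I" "finite Y" "prime p" "\<not> int p dvd e"
    and orth: "\<And>A B. A \<in> I \<Longrightarrow> B \<in> I \<Longrightarrow>
      [(\<Sum>y\<in>Y. u A y * v B y) = (if A = B then e else 0)] (mod int p)"
  shows "card I \<le> card Y"
proof -
  have p1: "p > 1" using assms(3) prime_gt_1_nat by blast
  define Phi where "Phi c = restrict (\<lambda>y. (\<Sum>A\<in>I. c A * u A y) mod int p) Y" for c
  let ?P = "\<lambda>J. PiE J (\<lambda>_. {0..<int p})"
  have recover: "[(\<Sum>y\<in>Y. Phi c y * v B y) = c B * e] (mod int p)" if "B \<in> I" for c B
  proof -
    have "[(\<Sum>y\<in>Y. Phi c y * v B y) = (\<Sum>y\<in>Y. (\<Sum>A\<in>I. c A * u A y) * v B y)] (mod int p)"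
      by (intro cong_sum cong_mult) (auto simp: Phi_def cong_def)
    also have "(\<Sum>y\<in>Y. (\<Sum>A\<in>I. c A * u A y) * v B y) = (\<Sum>A\<in>I. c A * (\<Sum>y\<in>Y. u A y * v B y))"
      by (simp add: sum_distrib_left sum_distrib_right mult.assoc) (rule sum.swap)
    also have "[\<dots> = (\<Sum>A\<in>I. c A * (if A = B then e else 0))] (mod int p)"
      using that by (intro cong_sum cong_mult orth) auto
    also have "(\<Sum>A\<in>I. c A * (if A = B then e else 0)) = c B * e"
      using that assms(1) by (simp add: if_distrib[of "\<lambda>x. _ * x"] cong: if_cong)
    finally show ?thesis .
  qed
  have "inj_on Phi (?P I)"
  proof (rule inj_onI)
    fix c c' assume c: "c \<in> ?P I" and c': "c' \<in> ?P I" and eq: "Phi c = Phi c'"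
    show "c = c'"
    proof (rule PiE_ext[OF c c'])
      fix B assume B: "B \<in> I"
      have "[c B * e = c' B * e] (mod int p)"
        using recover[OF B, of c] recover[OF B, of c'] eq by (metis cong_sym cong_trans)
      moreover have "coprime e (int p)"
        using assms(3,4) by (metis coprime_commute prime_imp_coprime prime_nat_int_transfer)
      ultimately have "[c B = c' B] (mod int p)"
        using cong_mult_rcancel by blast
      moreover have "c B \<in> {0..<int p}" "c' B \<in> {0..<int p}"
        using c c' B by (auto dest: PiE_mem)
      ultimately show "c B = c' B" by (simp add: cong_def)
    qed
  qed
  moreover have "Phi ` ?P I \<subseteq> ?P Y"
    using p1 by (auto simp: Phi_def)
  moreover have "finite (?P Y)" using assms(2) by (intro finite_PiE) auto
  ultimately have "card (?P I) \<le> card (?P Y)" by (metis card_inj_on_le)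
  then have "p ^ card I \<le> p ^ card Y"
    using assms(1,2) by (simp add: card_PiE)
  then show ?thesis using p1 by simp
qed

text \<open>Both sides count the \<open>t\<close>-subsets of \<open>A \<inter> B\<close>. The
  right-hand side factors the matrix with these entries through the \<open>t\<close>-subsets of
  \<open>R\<close>, which bounds its rank.\<close>

lemma choose_card_Int_eq_sum:
  assumes "finite R" "A \<subseteq> R"
  shows "int (card (A \<inter> B) choose t)
      = (\<Sum>T | T \<subseteq> R \<and> card T = t. of_bool (T \<subseteq> A) * of_bool (T \<subseteq> B))"
proof -
  have fin: "finite {T. T \<subseteq> R \<and> card T = t}" using assms(1) by auto
  have "{T. T \<subseteq> A \<inter> B \<and> card T = t} = {T \<in> {T. T \<subseteq> R \<and> card T = t}. T \<subseteq> A \<and> T \<subseteq> B}"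
    using assms by auto
  moreover have "card {T. T \<subseteq> A \<inter> B \<and> card T = t} = card (A \<inter> B) choose t"
    using assms by (intro n_subsets) (auto intro: finite_subset)
  ultimately show ?thesis
    using fin by (simp add: sum_of_bool_eq Int_def flip: of_bool_conj)
qed

lemma choose_le_of_intersecting_mod:
  fixes p q :: nat
  assumes "prime p" and q: "q = p ^ l"
    and F: "\<F> \<subseteq> Pow {1..n}" "card \<F> = m + s" and int: "intersecting_mod p k \<alpha> \<F>"
    and k: "s + 2 * q \<le> k" and neq: "\<not> [\<alpha> (s + q) = \<alpha> (s + 2 * q)] (mod p)"
  shows "m choose q \<le> n + (\<Sum>t<q. m choose t)"
proof -
  have p1: "p > 1" using assms(1) prime_gt_1_nat by blast
  have q0: "q > 0" using q p1 by simp
  have finF: "finite \<F>" using F(1) by (rule finite_subset) simp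
  obtain S where S: "S \<subseteq> \<F>" "card S = s"
    by (rule obtain_subset_with_card_n[of s \<F>]) (use F(2) in auto)
  define R where "R = \<F> - S"
  have finS: "finite S" and finR: "finite R"
    using finF S by (auto simp: R_def intro: finite_subset)
  have cR: "card R = m"
    using S F(2) finS by (simp add: R_def card_Diff_subset)
  \<comment> \<open>With \<open>j = card (A \<inter> B)\<close>, the argument of
    \<open>\<alpha>\<close> is the size of \<open>A \<union> B \<union> S\<close>: it falls from
    \<open>s + 2 * q\<close> at \<open>j = 0\<close> to \<open>s + q\<close> at
    \<open>j = q\<close>.\<close>
  define g where "g j = int (\<alpha> (s + 2 * q - j))" for j
  have "\<exists>e. \<forall>j<Suc q. (\<Sum>t<Suc q. e t * int (j choose t)) = g j"
    by (rule lower_unitriangular_solvable) auto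
  then obtain e where e: "\<forall>j<Suc q. (\<Sum>t<Suc q. e t * int (j choose t)) = g j" by blast
  have eq0: "\<not> int p dvd e q"
  proof
    assume dvd: "int p dvd e q"
    have gq: "g q = (\<Sum>t<q. e t * int (q choose t)) + e q"
      using e[rule_format, of q] by simp
    have "[g q = (\<Sum>t<q. e t * int (q choose t)) + 0] (mod int p)"
      unfolding gq using dvd by (intro cong_add cong_refl) (simp add: cong_0_iff)
    also have "[(\<Sum>t<q. e t * int (q choose t)) + 0 = (\<Sum>t<q. e t * int (0 choose t)) + 0] (mod int p)"
      using choose_add_prime_power_cong[OF assms(1), of _ l 0] q
      by (intro cong_sum cong_mult cong_add cong_refl) (auto simp: cong_int_iff)
    also have "(\<Sum>t<q. e t * int (0 choose t)) + 0 = g 0"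
      using e[rule_format, of 0] q0 by (simp add: binomial_eq_0)
    finally show False
      using neq q0 by (simp add: g_def cong_int_iff mult_2 add.assoc[symmetric])
  qed
  define I where "I = {A. A \<subseteq> R \<and> card A = q}"
  define L where "L = {T. T \<subseteq> R \<and> card T < q}"
  have cL: "card L = (\<Sum>t<q. m choose t)"
  proof -
    have "L = (\<Union>t<q. {T. T \<subseteq> R \<and> card T = t})" by (auto simp: L_def)
    also have "card \<dots> = (\<Sum>t<q. card {T. T \<subseteq> R \<and> card T = t})"
      using finR by (intro card_UN_disjoint) auto
    finally show ?thesis using n_subsets[OF finR] cR by simp
  qed
  have finL: "finite L" and finI: "finite I" using finR by (auto simp: L_def I_def)
  \<comment> \<open>One coordinate per point and one per set in \<open>L\<close>: the points
    contribute the Gram entry, and \<open>L\<close> subtracts the Newton terms with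
    \<open>t < q\<close>.\<close>
  define u where "u A = case_sum (\<lambda>x. of_bool (x \<in> \<Inter>(A \<union> S))) (\<lambda>T. - e (card T) * of_bool (T \<subseteq> A))"
    for A :: "nat set set"
  define v :: "nat set set \<Rightarrow> nat + nat set set \<Rightarrow> int" where
    "v B = case_sum (\<lambda>x. of_bool (x \<in> \<Inter>(B \<union> S))) (\<lambda>T. of_bool (T \<subseteq> B))" for B
  have "card I \<le> card ({1..n} <+> L)"
  proof (rule card_le_of_biorthogonal_mod[where u = u and v = v and e = "e q", OF _ _ assms(1) eq0])
    fix A B assume A: "A \<in> I" and B: "B \<in> I"
    have finA: "finite A" and finB: "finite B"
      using A B finR by (auto simp: I_def intro: finite_subset)
    have cAB: "card (A \<inter> B) \<le> q"
      using A finA by (metis (mono_tags) I_def card_mono inf_le1 mem_Collect_eq)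
    have "card (A \<union> B) + card (A \<inter> B) = 2 * q"
      using card_Un_Int[OF finA finB] A B by (simp add: I_def)
    moreover have "card (A \<union> B \<union> S) = card (A \<union> B) + s"
      using finA finB finS A B S by (subst card_Un_disjoint) (auto simp: I_def R_def)
    ultimately have cABS: "card (A \<union> B \<union> S) = s + 2 * q - card (A \<inter> B)" by simp
    have "[card (\<Inter>(A \<union> B \<union> S)) = \<alpha> (card (A \<union> B \<union> S))] (mod p)"
    proof -
      have "A \<union> B \<union> S \<subseteq> \<F>" using A B S by (auto simp: I_def R_def)
      moreover have "card (A \<union> B \<union> S) \<in> {1..k}"
        using cABS cAB k q0 by auto
      ultimately show ?thesis using int by (auto simp: intersecting_mod_def)
    qed
    then have main: "[int (card (\<Inter>(A \<union> B \<union> S))) = g (card (A \<inter> B))] (mod int p)"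
      by (simp add: g_def cABS cong_int_iff)
    \<comment> \<open>Since \<open>q > 0\<close>, the set \<open>A\<close> is nonempty; the
      intersection of an empty family would be the whole type.\<close>
    have "\<Inter>(A \<union> B \<union> S) \<subseteq> {1..n}"
    proof -
      obtain X where "X \<in> A" using A q0 by (fastforce simp: I_def)
      then show ?thesis using F A by (fastforce simp: I_def R_def)
    qed
    then have sum1: "(\<Sum>x\<in>{1..n}. u A (Inl x) * v B (Inl x)) = int (card (\<Inter>(A \<union> B \<union> S)))"
      by (simp add: u_def v_def sum_of_bool_eq flip: of_bool_conj)
         (rule arg_cong[where f = card], auto)
    have "(\<Sum>T\<in>L. u A (Inr T) * v B (Inr T))
        = (\<Sum>t<q. \<Sum>T | T \<in> L \<and> card T = t. - e (card T) * (of_bool (T \<subseteq> A) * of_bool (T \<subseteq> B)))"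
      using finL by (subst sum.group) (auto simp: u_def v_def L_def mult.assoc)
    also have "\<dots> = (\<Sum>t<q. - e t * (\<Sum>T | T \<subseteq> R \<and> card T = t. of_bool (T \<subseteq> A) * of_bool (T \<subseteq> B)))"
      unfolding sum_distrib_left by (intro sum.cong refl) (auto simp: L_def)
    also have "\<dots> = - (\<Sum>t<q. e t * int (card (A \<inter> B) choose t))"
      using A finR by (simp add: choose_card_Int_eq_sum I_def sum_negf)
    also have "\<dots> = e q * int (card (A \<inter> B) choose q) - g (card (A \<inter> B))"
      using e[rule_format, of "card (A \<inter> B)"] cAB by simp
    finally have sum2: "(\<Sum>T\<in>L. u A (Inr T) * v B (Inr T))
        = e q * int (card (A \<inter> B) choose q) - g (card (A \<inter> B))" .
    \<comment> \<open>As \<open>card (A \<inter> B) \<le> q\<close>, the binomial coefficient is 1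
      if \<open>A = B\<close> and 0 otherwise.\<close>
    have "e q * int (card (A \<inter> B) choose q) = (if A = B then e q else 0)"
    proof (cases "A = B")
      case False
      then have "card (A \<inter> B) \<noteq> q"
        using A B finA finB by (metis (mono_tags) I_def card_subset_eq inf_le1 inf_le2 mem_Collect_eq)
      with False cAB show ?thesis by simp
    qed (use A in \<open>simp add: I_def\<close>)
    then have "(\<Sum>y\<in>{1..n} <+> L. u A y * v B y)
        = int (card (\<Inter>(A \<union> B \<union> S))) - g (card (A \<inter> B)) + (if A = B then e q else 0)"
      using finL sum1 sum2 by (simp add: sum.Plus)
    also have "[\<dots> = 0 + (if A = B then e q else 0)] (mod int p)"
      using main by (intro cong_add cong_refl) (simp add: cong_diff_iff_cong_0)
    finally show "[(\<Sum>y\<in>{1..n} <+> L. u A y * v B y) = (if A = B then e q else 0)] (mod int p)"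
      by simp
  qed (use finL finI in auto)
  moreover have "card I = m choose q" using n_subsets[OF finR] cR by (simp add: I_def)
  moreover have "card ({1..n} <+> L) = n + card L" using finL by (simp add: card_Plus)
  ultimately show ?thesis using cL by simp
qed

text \<open>The left side is at least \<open>(m / q) ^ q\<close>, and each lower coefficient is at
  most \<open>m ^ (q - 1)\<close>. The threshold on \<open>m\<close> makes the lower terms, scaled
  by \<open>q ^ q\<close>, at most half of \<open>m ^ q\<close>, so they are absorbed.\<close>

lemma power_le_of_choose_le:
  assumes "q > 0" "m choose q \<le> n + (\<Sum>t<q. m choose t)" "2 * q ^ (q + 1) \<le> m"
  shows "real m ^ q \<le> 2 * real q ^ q * real n"
proof -
  have m0: "m > 0" using assms(1,3) by (metis gr0I le_zero_eq mult_is_0 power_not_zero zero_neq_numeral)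
  have "q \<le> q ^ (q + 1)" using assms(1) by (simp add: self_le_power)
  then have "q \<le> m" using assms(3) by linarith
  then have "(real m / real q) ^ q \<le> real (m choose q)"
    by (rule binomial_ge_n_over_k_pow_k)
  also have "\<dots> \<le> real n + (\<Sum>t<q. real (m choose t))"
    using assms(2) by (metis of_nat_add of_nat_le_iff of_nat_sum)
  also have "(\<Sum>t<q. real (m choose t)) \<le> (\<Sum>t<q. real m ^ (q - 1))"
  proof (rule sum_mono)
    fix t assume "t \<in> {..<q}"
    have "m choose t \<le> m ^ t" by (cases "t \<le> m") (auto simp: binomial_le_pow binomial_eq_0)
    also have "\<dots> \<le> m ^ (q - 1)" using m0 \<open>t \<in> {..<q}\<close> by (intro power_increasing) auto
    finally show "real (m choose t) \<le> real m ^ (q - 1)" by (metis of_nat_le_iff of_nat_power)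
  qed
  finally have "(real m / real q) ^ q \<le> real n + real q * real m ^ (q - 1)" by simp
  then have "real q ^ q * (real m / real q) ^ q \<le> real q ^ q * (real n + real q * real m ^ (q - 1))"
    by (intro mult_left_mono) auto
  then have 1: "real m ^ q \<le> real q ^ q * real n + real q ^ (q + 1) * real m ^ (q - 1)"
    using assms(1) by (simp add: power_divide algebra_simps)
  have "2 * real q ^ (q + 1) * real m ^ (q - 1) \<le> real m * real m ^ (q - 1)"
    using assms(3) by (intro mult_right_mono) (simp_all flip: of_nat_power of_nat_mult)
  also have "\<dots> = real m ^ q" using assms(1) by (simp flip: power_Suc)
  finally show ?thesis using 1 by simp
qed

section \<open>Periodic patterns\<close>

lemma finite_max_intersecting_range:
  "finite {card \<F> | \<F>. \<F> \<subseteq> Pow {1..n} \<and> intersecting_mod p k \<alpha> \<F>}"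
proof -
  have "{card \<F> | \<F>. \<F> \<subseteq> Pow {1..n} \<and> intersecting_mod p k \<alpha> \<F>} \<subseteq> card ` Pow (Pow {1..n})"
    by auto
  then show ?thesis by (rule finite_subset) auto
qed

lemma card_le_max_intersecting:
  assumes "\<F> \<subseteq> Pow {1..n}" "intersecting_mod p k \<alpha> \<F>"
  shows "card \<F> \<le> max_intersecting p k \<alpha> n"
  unfolding max_intersecting_def
  by (rule Max_ge[OF finite_max_intersecting_range]) (use assms in blast)

lemma max_intersecting_attained:
  obtains \<F> where "\<F> \<subseteq> Pow {1..n}" "intersecting_mod p k \<alpha> \<F>"
    "card \<F> = max_intersecting p k \<alpha> n"
proof -
  have "intersecting_mod p k \<alpha> {}" by (simp add: intersecting_mod_def)
  then have "{card \<F> | \<F>. \<F> \<subseteq> Pow {1..n} \<and> intersecting_mod p k \<alpha> \<F>} \<noteq> {}" by blast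
  from Max_in[OF finite_max_intersecting_range this] that show thesis
    unfolding max_intersecting_def by auto
qed

text \<open>
  The dual description of a family with \<open>m\<close> members: \<open>w S\<close> counts the points whose set of
  members containing them is \<open>S\<close>. Positive weight on singletons makes the members distinct.
\<close>

lemma le_max_intersecting_of_weights:
  fixes w :: "nat set \<Rightarrow> nat"
  assumes total: "(\<Sum>S\<in>Pow {..<m}. w S) \<le> n"
    and single: "\<And>j. j < m \<Longrightarrow> w {j} > 0"
    and cong: "\<And>G. G \<subseteq> {..<m} \<Longrightarrow> 1 \<le> card G \<Longrightarrow> card G \<le> k \<Longrightarrow>
      [(\<Sum>S | G \<subseteq> S \<and> S \<subseteq> {..<m}. w S) = \<alpha> (card G)] (mod p)"
  shows "m \<le> max_intersecting p k \<alpha> n"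
proof -
  \<comment> \<open>The points are pairs of a type \<open>S\<close> and a label below
    \<open>w S\<close>; \<open>f\<close> places them in \<open>{1..n}\<close>, and
    \<open>M j\<close> collects those whose type contains \<open>j\<close>.\<close>
  define X where "X = Sigma (Pow {..<m}) (\<lambda>S. {..<w S})"
  have finX: "finite X" by (auto simp: X_def)
  have "card X \<le> card {1..n}"
    using total by (simp add: X_def card_SigmaI)
  then obtain f where f: "f ` X \<subseteq> {1..n}" "inj_on f X"
    using finX by (metis card_le_inj finite_atLeastAtMost)
  define M where "M j = f ` {x \<in> X. j \<in> fst x}" for j
  have M_inj: "inj_on M {..<m}"
  proof (rule inj_onI)
    fix i j assume i: "i \<in> {..<m}" and j: "j \<in> {..<m}" and eq: "M i = M j"
    have x: "({i}, 0) \<in> X" using i single by (auto simp: X_def)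
    then have "f ({i}, 0) \<in> M j" using eq by (auto simp: M_def)
    then obtain y where "y \<in> X" "j \<in> fst y" "f y = f ({i}, 0)" by (auto simp: M_def)
    with x f(2) have "j \<in> fst ({i}, 0::nat)" by (metis inj_onD)
    then show "i = j" by simp
  qed
  have "intersecting_mod p k \<alpha> (M ` {..<m})"
    unfolding intersecting_mod_def
  proof (intro ballI allI impI, elim conjE)
    fix i \<G> assume i: "i \<in> {1..k}" and G: "\<G> \<subseteq> M ` {..<m}" "card \<G> = i"
    obtain G where G': "G \<subseteq> {..<m}" "\<G> = M ` G" using G(1) by (metis subset_imageE)
    have cG: "card G = i"
      using G(2) G' M_inj by (metis card_image inj_on_subset)
    then have ne: "G \<noteq> {}" using i by auto
    \<comment> \<open>By injectivity of \<open>f\<close>, a common point of the \<open>M j\<close>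
      has a single preimage, whose type therefore contains all of \<open>G\<close>.\<close>
    have "\<Inter>(M ` G) = f ` {x \<in> X. G \<subseteq> fst x}"
    proof
      show "\<Inter>(M ` G) \<subseteq> f ` {x \<in> X. G \<subseteq> fst x}"
      proof
        fix z assume z: "z \<in> \<Inter>(M ` G)"
        obtain g where "g \<in> G" using ne by blast
        with z obtain x where x: "x \<in> X" "z = f x" by (auto simp: M_def)
        have "j \<in> fst x" if "j \<in> G" for j
        proof -
          have "f x \<in> M j" using z x that by auto
          then obtain y where "y \<in> X" "j \<in> fst y" "f y = f x" by (auto simp: M_def)
          with x f(2) show ?thesis by (metis inj_onD)
        qed
        with x show "z \<in> f ` {x \<in> X. G \<subseteq> fst x}" by auto
      qed
      show "f ` {x \<in> X. G \<subseteq> fst x} \<subseteq> \<Inter>(M ` G)" by (auto simp: M_def)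
    qed
    then have "card (\<Inter>\<G>) = card {x \<in> X. G \<subseteq> fst x}"
      using f(2) G'(2) by (simp add: card_image inj_on_subset)
    also have "{x \<in> X. G \<subseteq> fst x} = Sigma {S. G \<subseteq> S \<and> S \<subseteq> {..<m}} (\<lambda>S. {..<w S})"
      by (auto simp: X_def)
    also have "card \<dots> = (\<Sum>S | G \<subseteq> S \<and> S \<subseteq> {..<m}. w S)"
      by (subst card_SigmaI) (auto intro: finite_subset[of _ "Pow {..<m}"])
    finally show "[card (\<Inter>\<G>) = \<alpha> i] (mod p)"
      using cong[OF G'(1)] cG i by simp
  qed
  moreover have "M ` {..<m} \<subseteq> Pow {1..n}" using f(1) by (auto simp: M_def)
  ultimately have "card (M ` {..<m}) \<le> max_intersecting p k \<alpha> n"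
    by (rule card_le_max_intersecting[rotated])
  then show ?thesis using M_inj by (simp add: card_image)
qed

text \<open>Removing \<open>G\<close> gives a bijection onto subsets of \<open>R - G\<close>. The
  case \<open>d < card G\<close> is separate because truncated subtraction would give the binomial
  coefficient the value 1.\<close>

lemma card_supersets:
  assumes "finite R" "G \<subseteq> R"
  shows "card {S. G \<subseteq> S \<and> S \<subseteq> R \<and> card S = d}
      = (if card G \<le> d then (card R - card G) choose (d - card G) else 0)"
proof (cases "card G \<le> d")
  case True
  have finG: "finite G" using assms finite_subset by blast
  have "bij_betw (\<lambda>T. G \<union> T) {T. T \<subseteq> R - G \<and> card T = d - card G} {S. G \<subseteq> S \<and> S \<subseteq> R \<and> card S = d}"
  proof (rule bij_betwI[where g = "\<lambda>S. S - G"])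
    show "(\<lambda>T. G \<union> T) \<in> {T. T \<subseteq> R - G \<and> card T = d - card G} \<rightarrow> {S. G \<subseteq> S \<and> S \<subseteq> R \<and> card S = d}"
    proof
      fix T assume T: "T \<in> {T. T \<subseteq> R - G \<and> card T = d - card G}"
      then have "finite T" using assms(1) finite_subset by blast
      then have "card (G \<union> T) = card G + card T"
        using T finG by (intro card_Un_disjoint) auto
      then show "G \<union> T \<in> {S. G \<subseteq> S \<and> S \<subseteq> R \<and> card S = d}" using T True assms(2) by auto
    qed
    show "(\<lambda>S. S - G) \<in> {S. G \<subseteq> S \<and> S \<subseteq> R \<and> card S = d} \<rightarrow> {T. T \<subseteq> R - G \<and> card T = d - card G}"
      using finG by (auto simp: card_Diff_subset)
  qed auto
  then have "card {S. G \<subseteq> S \<and> S \<subseteq> R \<and> card S = d} = card {T. T \<subseteq> R - G \<and> card T = d - card G}"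
    by (rule bij_betw_same_card[symmetric])
  also have "\<dots> = (card R - card G) choose (d - card G)"
    using assms finG n_subsets[of "R - G"] by (simp add: card_Diff_subset)
  finally show ?thesis using True by simp
next
  case False
  have empty: "{S. G \<subseteq> S \<and> S \<subseteq> R \<and> card S = d} = {}"
    using False assms(1) by (auto dest: card_mono[rotated] intro: finite_subset)
  show ?thesis unfolding empty using False by simp
qed

text \<open>By symmetry of binomial coefficients. No case distinction remains: if \<open>G\<close>
  is too large, then \<open>card R - card G < d\<close> and the coefficient is 0.\<close>

lemma card_supersets_codim:
  assumes "finite R" "G \<subseteq> R" "d \<le> card R"
  shows "card {S. G \<subseteq> S \<and> S \<subseteq> R \<and> card S = card R - d} = (card R - card G) choose d"
proof -
  have cG: "card G \<le> card R" using assms(1,2) by (rule card_mono)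
  show ?thesis
  proof (cases "card G \<le> card R - d")
    case True
    have "(card R - card G) choose (card R - d - card G) = (card R - card G) choose d"
      using True assms(3) cG by (subst binomial_symmetric) auto
    with True show ?thesis using assms by (simp add: card_supersets)
  next
    case False
    then have "(card R - card G) choose d = 0" using assms(3) cG by (intro binomial_eq_0) linarith
    with False show ?thesis using assms by (simp add: card_supersets)
  qed
qed

text \<open>
  The eventually periodic pattern is matched by \<open>c d\<close> copies of every \<open>d\<close>-set and \<open>e d\<close>
  copies of every complement of a \<open>d\<close>-set, for \<open>d < q\<close>. An \<open>i\<close>-set lies in \<open>m - i choose d\<close>
  of these complements, a \<open>q\<close>-periodic function of \<open>i\<close> modulo \<open>p\<close>, so the \<open>e d\<close> take care of the
  indices \<open>i \<ge> q\<close>; the \<open>c d\<close> correct the indices \<open>i < q\<close> and do not affect the others.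
\<close>

lemma periodic_pattern_weights:
  fixes p q m :: nat
  assumes "prime p" and q: "q = p ^ l" and m: "q \<le> m" "k \<le> m"
    and per: "\<forall>i. q \<le> i \<and> i + q \<le> k \<longrightarrow> \<alpha> (i + q) = \<alpha> i"
  shows "\<exists>c e :: nat \<Rightarrow> nat. (\<forall>d. c d < p \<and> e d < p) \<and> (\<forall>i\<in>{1..k}.
      [(\<Sum>d<q. c d * (if i \<le> d then (m - i) choose (d - i) else 0)) + (\<Sum>d<q. e d * ((m - i) choose d))
        = \<alpha> i] (mod p))"
proof -
  have p1: "p > 1" using assms(1) prime_gt_1_nat by blast
  have q0: "q > 0" using q p1 by simp
  \<comment> \<open>The periodic continuation of \<open>\<alpha>\<close> from
    \<open>{q..<2 * q}\<close> to all indices; it is evaluated at \<open>m - j\<close>, which may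
    exceed \<open>k\<close>.\<close>
  define b where "b i = \<alpha> (q + i mod q)" for i
  have b_eq: "\<alpha> i = b i" if "q \<le> i" "i \<le> k" for i
  proof -
    have "\<alpha> (q + r + t * q) = \<alpha> (q + r)" if "q + r + t * q \<le> k" for r t
      using that
    proof (induction t)
      case (Suc t)
      then show ?case using per[rule_format, of "q + r + t * q"] by (simp add: algebra_simps)
    qed simp
    from this[of "i mod q" "(i - q) div q"] that show ?thesis
      by (simp add: b_def mod_if[of i] le_mod_geq add.assoc)
  qed
  define T where "T i d = (if i \<le> d then int ((m - i) choose (d - i)) else 0)" for i d
  have "\<exists>e. \<forall>j<q. (\<Sum>d<q. e d * int (j choose d)) = int (b (m - j))"
    by (rule lower_unitriangular_solvable) auto
  then obtain e where e: "\<And>j. j < q \<Longrightarrow> (\<Sum>d<q. e d * int (j choose d)) = int (b (m - j))" by blast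
  have "\<exists>c. \<forall>i<q. (\<Sum>d<q. c d * T i d) = int (\<alpha> i) - (\<Sum>d<q. e d * int ((m - i) choose d))"
    by (rule upper_unitriangular_solvable) (auto simp: T_def)
  then obtain c where c: "\<And>i. i < q \<Longrightarrow>
      (\<Sum>d<q. c d * T i d) = int (\<alpha> i) - (\<Sum>d<q. e d * int ((m - i) choose d))" by blast
  have e_per: "[(\<Sum>d<q. e d * int ((m - i) choose d)) = int (b i)] (mod int p)" if "i \<le> m" for i
  proof -
    let ?j = "(m - i) mod q"
    have "[(\<Sum>d<q. e d * int ((m - i) choose d)) = (\<Sum>d<q. e d * int (?j choose d))] (mod int p)"
      using choose_mod_prime_power_cong[OF assms(1), of _ l "m - i"] q
      by (intro cong_sum cong_mult cong_refl) (auto simp: cong_int_iff)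
    also have "(\<Sum>d<q. e d * int (?j choose d)) = int (b (m - ?j))"
      using q0 by (intro e) simp
    also have "b (m - ?j) = b i"
    proof -
      have "m - ?j = i + (m - i) div q * q"
        using that div_mult_mod_eq[of "m - i" q] by linarith
      then show ?thesis by (simp add: b_def)
    qed
    finally show ?thesis .
  qed
  have sum_eq: "[(\<Sum>d<q. c d * T i d) + (\<Sum>d<q. e d * int ((m - i) choose d)) = int (\<alpha> i)] (mod int p)"
    if "1 \<le> i" "i \<le> k" for i
  proof (cases "i < q")
    case True
    then show ?thesis using c by simp
  next
    case False
    then have "(\<Sum>d<q. c d * T i d) = 0" by (intro sum.neutral) (auto simp: T_def)
    with False e_per[of i] b_eq[of i] that m show ?thesis by simp
  qed
  \<comment> \<open>Reduction modulo \<open>p\<close> turns the integer solutions into nonnegative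
    multiplicities below \<open>p\<close>, which keeps the total weight small.\<close>
  define c' e' where "c' d = nat (c d mod int p)" and "e' d = nat (e d mod int p)" for d
  have c'e': "int (c' d) = c d mod int p" "int (e' d) = e d mod int p" for d
    using p1 by (auto simp: c'_def e'_def)
  show ?thesis
  proof (rule exI[of _ c'], rule exI[of _ e'], intro conjI ballI allI)
    show "c' d < p" "e' d < p" for d
      using p1 by (simp_all add: c'_def e'_def nat_less_iff)
    fix i assume "i \<in> {1..k}"
    then have i: "1 \<le> i" "i \<le> k" by auto
    have "[(\<Sum>d<q. int (c' d) * T i d) + (\<Sum>d<q. int (e' d) * int ((m - i) choose d))
        = (\<Sum>d<q. c d * T i d) + (\<Sum>d<q. e d * int ((m - i) choose d))] (mod int p)"
      by (intro cong_add cong_sum cong_mult cong_refl) (simp_all add: c'e')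
    also note sum_eq[OF i]
    also have "(\<Sum>d<q. int (c' d) * T i d) + (\<Sum>d<q. int (e' d) * int ((m - i) choose d))
        = int ((\<Sum>d<q. c' d * (if i \<le> d then (m - i) choose (d - i) else 0))
            + (\<Sum>d<q. e' d * ((m - i) choose d)))"
      by (simp add: T_def if_distrib[of int] cong: if_cong)
    finally show "[(\<Sum>d<q. c' d * (if i \<le> d then (m - i) choose (d - i) else 0))
        + (\<Sum>d<q. e' d * ((m - i) choose d)) = \<alpha> i] (mod p)"
      by (simp only: cong_int_iff)
  qed
qed

lemma le_max_intersecting_of_periodic:
  fixes p q m :: nat
  assumes "prime p" and q: "q = p ^ l" "l \<ge> 1" and m: "q \<le> m" "k \<le> m"
    and per: "\<forall>i. q \<le> i \<and> i + q \<le> k \<longrightarrow> \<alpha> (i + q) = \<alpha> i"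
    and n: "3 * p * q * m ^ (q - 1) \<le> n"
  shows "m \<le> max_intersecting p k \<alpha> n"
proof -
  have p1: "p > 1" using assms(1) prime_gt_1_nat by blast
  have q1: "q > 1" unfolding q(1) using p1 q(2) by (intro one_less_power) auto
  obtain c e :: "nat \<Rightarrow> nat" where bound: "\<forall>d. c d < p \<and> e d < p"
    and sol: "\<forall>i\<in>{1..k}.
      [(\<Sum>d<q. c d * (if i \<le> d then (m - i) choose (d - i) else 0)) + (\<Sum>d<q. e d * ((m - i) choose d))
        = \<alpha> i] (mod p)"
    using periodic_pattern_weights[OF assms(1) q(1) m per] by (elim exE conjE)
  \<comment> \<open>The \<open>p\<close> extra copies of each singleton change no count modulo
    \<open>p\<close> but make the singleton weights positive.\<close>
  define w where "w S = (\<Sum>d<q. c d * of_bool (card S = d)) + (\<Sum>d<q. e d * of_bool (card S = m - d))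
      + p * of_bool (card S = 1)" for S :: "nat set"
  have w_sum: "(\<Sum>S | G \<subseteq> S \<and> S \<subseteq> {..<m}. w S)
      = (\<Sum>d<q. c d * (if card G \<le> d then (m - card G) choose (d - card G) else 0))
        + (\<Sum>d<q. e d * ((m - card G) choose d))
        + p * card {S. G \<subseteq> S \<and> S \<subseteq> {..<m} \<and> card S = 1}" if "G \<subseteq> {..<m}" for G
  proof -
    let ?U = "{S. G \<subseteq> S \<and> S \<subseteq> {..<m}}"
    have fin: "finite ?U" by (rule finite_subset[of _ "Pow {..<m}"]) auto
    have cnt: "(\<Sum>S\<in>?U. a * of_bool (card S = d)) = a * card {S. G \<subseteq> S \<and> S \<subseteq> {..<m} \<and> card S = d}"
      for a d :: nat
      using fin by (simp add: sum_of_bool_eq Int_def conj_ac flip: sum_distrib_left)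
    have "(\<Sum>S\<in>?U. w S) = (\<Sum>d<q. \<Sum>S\<in>?U. c d * of_bool (card S = d))
        + (\<Sum>d<q. \<Sum>S\<in>?U. e d * of_bool (card S = m - d)) + (\<Sum>S\<in>?U. p * of_bool (card S = 1))"
      unfolding w_def sum.distrib
      by (intro arg_cong2[where f = "(+)"] refl sum.swap)
    also have "(\<Sum>d<q. \<Sum>S\<in>?U. c d * of_bool (card S = d))
        = (\<Sum>d<q. c d * (if card G \<le> d then (m - card G) choose (d - card G) else 0))"
      unfolding cnt card_supersets[OF finite_lessThan that] card_lessThan ..
    also have "(\<Sum>d<q. \<Sum>S\<in>?U. e d * of_bool (card S = m - d)) = (\<Sum>d<q. e d * ((m - card G) choose d))"
      unfolding cnt using card_supersets_codim[OF _ that] m by (intro sum.cong refl) simp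
    also note cnt
    finally show ?thesis .
  qed
  show ?thesis
  proof (rule le_max_intersecting_of_weights)
    show "w {j} > 0" for j using p1 by (simp add: w_def)
  next
    fix G assume G: "G \<subseteq> {..<m}" "1 \<le> card G" "card G \<le> k"
    have "[(\<Sum>S | G \<subseteq> S \<and> S \<subseteq> {..<m}. w S) = \<alpha> (card G) + 0] (mod p)"
      unfolding w_sum[OF G(1)] using G(2,3) by (intro cong_add sol[rule_format]) (auto simp: cong_0_iff)
    then show "[(\<Sum>S | G \<subseteq> S \<and> S \<subseteq> {..<m}. w S) = \<alpha> (card G)] (mod p)" by simp
  next
    have choose_le: "m choose d \<le> m ^ (q - 1)" if "d < q" for d
    proof -
      have "m choose d \<le> m ^ d" using that m by (intro binomial_le_pow) simp
      also have "\<dots> \<le> m ^ (q - 1)" using that m by (intro power_increasing) auto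
      finally show ?thesis .
    qed
    have part: "(\<Sum>d<q. a d * (m choose d)) \<le> q * (p * m ^ (q - 1))" if "\<And>d. a d < p" for a :: "nat \<Rightarrow> nat"
    proof -
      have "(\<Sum>d<q. a d * (m choose d)) \<le> (\<Sum>d<q. p * m ^ (q - 1))"
        using that choose_le by (intro sum_mono mult_mono) (auto intro: less_imp_le)
      then show ?thesis by simp
    qed
    have "(\<Sum>S\<in>Pow {..<m}. w S) = (\<Sum>d<q. c d * (m choose d)) + (\<Sum>d<q. e d * (m choose d)) + p * m"
      using w_sum[of "{}"] n_subsets[of "{..<m}" 1] by (simp add: Pow_def)
    \<comment> \<open>The last summand uses \<open>m = m choose 1 \<le> m ^ (q - 1)\<close>, which
      relies on \<open>q > 1\<close>.\<close>
    also have "\<dots> \<le> q * (p * m ^ (q - 1)) + q * (p * m ^ (q - 1)) + p * m ^ (q - 1)"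
      using part[of c] part[of e] bound choose_le[of 1] q1 by (intro add_mono mult_left_mono) auto
    also have "\<dots> \<le> 3 * p * q * m ^ (q - 1)"
      using mult_le_mono1[of 1 q "p * m ^ (q - 1)"] q1 by (simp add: algebra_simps)
    finally show "(\<Sum>S\<in>Pow {..<m}. w S) \<le> n" using n by linarith
  qed
qed

section \<open>Asymptotics\<close>

lemma max_intersecting_bigo_of_not_periodic:
  fixes p q k :: nat
  assumes "prime p" and q: "q = p ^ l" and \<alpha>: "\<alpha> \<in> patterns p k"
    and i: "q \<le> i" "i + q \<le> k" "\<alpha> (i + q) \<noteq> \<alpha> i"
  shows "(\<lambda>n. real (max_intersecting p k \<alpha> n)) \<in> O(\<lambda>n. real n powr (1 / real q))"
proof -
  have q0: "q > 0" using q assms(1) by (simp add: prime_gt_0_nat)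
  \<comment> \<open>With \<open>s\<close> members fixed, the extreme union sizes
    \<open>s + q\<close> and \<open>s + 2 * q\<close> are the two indices where periodicity
    fails.\<close>
  define s where "s = i - q"
  have "\<alpha> j < p" if "j \<in> {1..k}" for j
    using PiE_mem[OF \<alpha>[unfolded patterns_def] that] by simp
  then have "\<alpha> i < p" "\<alpha> (i + q) < p"
    using i q0 by auto
  moreover have sq: "s + q = i" "s + 2 * q = i + q" using i by (auto simp: s_def)
  ultimately have neq: "\<not> [\<alpha> (s + q) = \<alpha> (s + 2 * q)] (mod p)"
    unfolding sq using i(3) by (simp add: cong_def)
  have sk: "s + 2 * q \<le> k" using i by (simp add: s_def)
  define C where "C = real (s + 2 * q ^ (q + 1) + 2 * q)"
  have "real (max_intersecting p k \<alpha> n) \<le> C * real n powr (1 / real q)" if n: "n \<ge> 1" for n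
  proof -
    let ?r = "real n powr (1 / real q)"
    have r1: "?r \<ge> 1" using n by (intro ge_one_powr_ge_zero) auto
    have rq: "?r ^ q = real n" using n q0 by (simp add: powr_power)
    define m where "m = max_intersecting p k \<alpha> n - s"
    have "real m \<le> real (2 * q ^ (q + 1)) + 2 * real q * ?r"
    proof (cases "2 * q ^ (q + 1) \<le> m")
      case True
      then have "m > 0" using q0 by (metis bot_nat_0.not_eq_extremum le_zero_eq mult_is_0 power_not_zero zero_neq_numeral)
      then have M: "max_intersecting p k \<alpha> n = m + s" by (simp add: m_def)
      obtain \<F> where F: "\<F> \<subseteq> Pow {1..n}" "intersecting_mod p k \<alpha> \<F>" "card \<F> = m + s"
        using max_intersecting_attained[of n p k \<alpha>] M by metis
      have "real m ^ q \<le> 2 * real q ^ q * real n"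
        by (rule power_le_of_choose_le[OF q0 choose_le_of_intersecting_mod[OF assms(1) q F(1,3,2) sk neq] True])
      \<comment> \<open>Weakening 2 to \<open>2 ^ q\<close> makes the bound an exact
        \<open>q\<close>-th power.\<close>
      also have "\<dots> \<le> 2 ^ q * real q ^ q * real n"
        using q0 by (intro mult_right_mono) (auto simp: self_le_power)
      also have "\<dots> = (2 * real q * ?r) ^ q" by (simp add: power_mult_distrib rq)
      finally have "real m \<le> 2 * real q * ?r"
        using q0 by (subst (asm) power_mono_iff) auto
      then show ?thesis by (simp add: add_increasing)
    next
      case False
      then have "real m \<le> real (2 * q ^ (q + 1))" by linarith
      also have "\<dots> \<le> real (2 * q ^ (q + 1)) + 2 * real q * ?r" by simp
      finally show ?thesis .
    qed
    moreover have "real (max_intersecting p k \<alpha> n) \<le> real s + real m" by (simp add: m_def)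
    moreover have "real (s + 2 * q ^ (q + 1)) * 1 \<le> real (s + 2 * q ^ (q + 1)) * ?r"
      using r1 by (intro mult_left_mono) auto
    ultimately show ?thesis by (simp add: C_def algebra_simps)
  qed
  then show ?thesis
    by (intro bigoI[where c = C] eventually_mono[OF eventually_ge_at_top[of 1]]) simp
qed

lemma max_intersecting_bigomega_of_periodic:
  fixes p q k :: nat
  assumes "prime p" and q: "q = p ^ l" "l \<ge> 1"
    and per: "\<forall>i. q \<le> i \<and> i + q \<le> k \<longrightarrow> \<alpha> (i + q) = \<alpha> i"
  shows "(\<lambda>n. real (max_intersecting p k \<alpha> n)) \<in> \<Omega>(\<lambda>n. real n powr (1 / real (q - 1)))"
proof -
  have p1: "p > 1" using assms(1) prime_gt_1_nat by blast
  have q1: "q > 1" unfolding q(1) using p1 q(2) by (intro one_less_power) auto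
  \<comment> \<open>For \<open>K \<le> r\<close> the integer part \<open>m\<close> of
    \<open>r\<close> is at least \<open>q\<close> and \<open>k\<close>, and \<open>K \<ge> 2\<close>
    gives \<open>r \<le> 2 * m\<close>.\<close>
  define K where "K = max 2 (max q k)"
  have K2: "K \<ge> 2" by (simp add: K_def)
  define D where "D = 3 * p * q"
  have D0: "D > 0" using p1 q1 by (simp add: D_def)
  let ?a = "1 / real (q - 1)"
  have "real n powr ?a \<le> 2 * real D powr ?a * real (max_intersecting p k \<alpha> n)"
    if n: "n \<ge> D * K ^ (q - 1)" for n
  proof -
    \<comment> \<open>The real solution of \<open>D * r ^ (q - 1) = n\<close>; its integer part is
      the size of the constructed family.\<close>
    define r where "r = (real n / real D) powr ?a"
    have "D * K ^ (q - 1) > 0" using D0 K2 by simp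
    then have n0: "n > 0" using n by linarith
    have rq: "r ^ (q - 1) = real n / real D"
      using n0 D0 q1 by (simp add: r_def powr_power)
    have r0: "r \<ge> 0" by (simp add: r_def)
    have "real K ^ (q - 1) \<le> r ^ (q - 1)"
      unfolding rq using n D0 by (simp add: field_simps flip: of_nat_power of_nat_mult)
    then have rK: "real K \<le> r"
      using q1 r0 by (subst (asm) power_mono_iff) auto
    define m where "m = nat \<lfloor>r\<rfloor>"
    have mr: "real m \<le> r" "r \<le> real m + 1" using r0 by (auto simp: m_def) 
    have Km: "K \<le> m" using rK r0 by (simp add: m_def le_nat_floor)
    have "real m ^ (q - 1) \<le> r ^ (q - 1)" using mr by (intro power_mono) auto
    then have "real (D * m ^ (q - 1)) \<le> real n"
      unfolding rq using D0 by (simp add: field_simps)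
    then have "D * m ^ (q - 1) \<le> n" by (simp only: of_nat_le_iff)
    then have "m \<le> max_intersecting p k \<alpha> n"
      using Km by (intro le_max_intersecting_of_periodic[OF assms(1) q _ _ per]) (auto simp: D_def K_def)
    moreover have "r \<le> 2 * real m" using mr rK by (simp add: K_def)
    ultimately have "r \<le> 2 * real (max_intersecting p k \<alpha> n)" by simp
    moreover have "real n powr ?a = real D powr ?a * r"
      using D0 by (simp add: r_def powr_divide)
    moreover have "real D powr ?a * r \<le> real D powr ?a * (2 * real (max_intersecting p k \<alpha> n))"
      using calculation(1) by (intro mult_left_mono) auto
    ultimately show ?thesis by (simp add: mult_ac)
  qed
  then show ?thesis
    unfolding bigomega_iff_bigo
    by (intro bigoI[where c = "2 * real D powr ?a"]
        eventually_mono[OF eventually_ge_at_top[of "D * K ^ (q - 1)"]]) simp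
qed

text \<open>The entries at \<open>1, ..., 2 * q - 1\<close> determine the pattern: for
  \<open>i \<ge> 2 * q\<close> the entry at \<open>i\<close> equals that at
  \<open>i - q \<ge> q\<close>.\<close>

lemma card_periodic_patterns_le:
  fixes p q k :: nat
  assumes "p > 0" "q > 0"
  shows "card {\<alpha> \<in> patterns p k. \<forall>i. q \<le> i \<and> i + q \<le> k \<longrightarrow> \<alpha> (i + q) = \<alpha> i} \<le> p ^ (2 * q - 1)"
proof -
  let ?V = "{\<alpha> \<in> patterns p k. \<forall>i. q \<le> i \<and> i + q \<le> k \<longrightarrow> \<alpha> (i + q) = \<alpha> i}"
  let ?P = "{1..2 * q - 1} \<rightarrow>\<^sub>E {0..<p}"
  \<comment> \<open>If \<open>k < 2 * q - 1\<close>, the missing entries are padded with 0 so that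
    the values stay below \<open>p\<close>.\<close>
  define h where "h \<alpha> = restrict (\<lambda>i. if i \<le> k then \<alpha> i else 0) {1..2 * q - 1}" for \<alpha> :: "nat \<Rightarrow> nat"
  have "inj_on h ?V"
  proof (rule inj_onI)
    fix \<alpha> \<beta> assume \<alpha>: "\<alpha> \<in> ?V" and \<beta>: "\<beta> \<in> ?V" and eq: "h \<alpha> = h \<beta>"
    have "\<alpha> i = \<beta> i" if "1 \<le> i" "i \<le> k" for i
      using that
    proof (induction i rule: less_induct)
      case (less i)
      show ?case
      proof (cases "i \<le> 2 * q - 1")
        case True
        then show ?thesis using fun_cong[OF eq, of i] less.prems by (simp add: h_def)
      next
        case False
        then have i: "q \<le> i - q" "i - q + q = i" "i - q < i" using assms by auto
        then have "\<alpha> i = \<alpha> (i - q)" "\<beta> i = \<beta> (i - q)"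
          using \<alpha> \<beta> less.prems by (metis (mono_tags, lifting) mem_Collect_eq)+
        then show ?thesis using less.IH[of "i - q"] less.prems i assms by simp
      qed
    qed
    with \<alpha> \<beta> show "\<alpha> = \<beta>"
      by (intro PiE_ext[of \<alpha> "{1..k}" "\<lambda>_. {0..<p}" \<beta>]) (auto simp: patterns_def)
  qed
  moreover have "h ` ?V \<subseteq> ?P"
  proof (intro image_subsetI PiE_I)
    fix \<alpha> i assume "\<alpha> \<in> ?V" "i \<in> {1..2 * q - 1}"
    then show "h \<alpha> i \<in> {0..<p}"
      using assms PiE_mem[of \<alpha> "{1..k}" "\<lambda>_. {0..<p}" i] by (simp add: h_def patterns_def)
  qed (auto simp: h_def)
  moreover have "finite ?P" by (intro finite_PiE) auto
  ultimately have "card ?V \<le> card ?P" by (rule card_inj_on_le)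
  then show ?thesis by (simp add: card_PiE)
qed

theorem theoremA4:
  fixes p k l :: nat
  assumes "prime p" and "k \<ge> 1" and "l \<ge> 1"
  shows "card {\<alpha> \<in> patterns p k.
            (\<lambda>n. real (max_intersecting p k \<alpha> n)) \<in> \<Omega>(\<lambda>n. real n powr (1 / (real p ^ l - 1)))}
           \<le> p ^ (2 * p ^ l - 1)
       \<and> (\<forall>\<alpha> \<in> patterns p k.
            (\<lambda>n. real (max_intersecting p k \<alpha> n)) \<notin> \<Omega>(\<lambda>n. real n powr (1 / (real p ^ l - 1)))
            \<longrightarrow> (\<lambda>n. real (max_intersecting p k \<alpha> n)) \<in> O(\<lambda>n. real n powr (1 / real p ^ l)))"
proof -
  define q where "q = p ^ l"
  have p1: "p > 1" using assms(1) prime_gt_1_nat by blast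
  have q1: "q > 1" unfolding q_def using p1 assms(3) by (intro one_less_power) auto
  have rq: "real p ^ l = real q" "real q - 1 = real (q - 1)"
    using q1 by (simp_all add: q_def of_nat_diff)
  let ?f = "\<lambda>\<alpha> n. real (max_intersecting p k \<alpha> n)"
  let ?per = "\<lambda>\<alpha>. \<forall>i. q \<le> i \<and> i + q \<le> k \<longrightarrow> \<alpha> (i + q) = \<alpha> i"
  have big: "?f \<alpha> \<in> O(\<lambda>n. real n powr (1 / real q))" if "\<alpha> \<in> patterns p k" "\<not> ?per \<alpha>" for \<alpha>
    using that max_intersecting_bigo_of_not_periodic[OF assms(1) q_def that(1)] by blast
  have omega: "?f \<alpha> \<in> \<Omega>(\<lambda>n. real n powr (1 / real (q - 1)))" if "?per \<alpha>" for \<alpha>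
    using max_intersecting_bigomega_of_periodic[OF assms(1) q_def assms(3) that] .
  \<comment> \<open>A non-periodic pattern has the upper bound with exponent \<open>1 / q\<close>,
    and \<open>1 / q < 1 / (q - 1)\<close> rules out the lower bound.\<close>
  have omega_imp: "?per \<alpha>"
    if "\<alpha> \<in> patterns p k" "?f \<alpha> \<in> \<Omega>(\<lambda>n. real n powr (1 / real (q - 1)))" for \<alpha>
  proof (rule ccontr)
    assume "\<not> ?per \<alpha>"
    with that big have "(\<lambda>n. real n powr (1 / real (q - 1))) \<in> O(\<lambda>n. real n powr (1 / real q))"
      unfolding bigomega_iff_bigo by (blast intro: landau_o.big_trans)
    moreover have "1 / real q < 1 / real (q - 1)"
      using q1 by (intro divide_strict_left_mono) auto
    ultimately show False
      using powr_bigo_iff[OF filterlim_real_sequentially] by (simp add: not_less[symmetric])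
  qed
  have "finite {\<alpha> \<in> patterns p k. ?per \<alpha>}"
    unfolding patterns_def by (rule finite_subset[OF _ finite_PiE[of "{1..k}" "\<lambda>_. {0..<p}"]]) auto
  then have "card {\<alpha> \<in> patterns p k. ?f \<alpha> \<in> \<Omega>(\<lambda>n. real n powr (1 / real (q - 1)))}
      \<le> card {\<alpha> \<in> patterns p k. ?per \<alpha>}"
    by (rule card_mono) (use omega_imp in blast)
  also have "\<dots> \<le> p ^ (2 * q - 1)"
    using p1 q1 by (intro card_periodic_patterns_le) auto
  finally show ?thesis
    unfolding rq using big omega by (simp add: q_def) blast
qed

end
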